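(* Let $n \ge 1$ and $t \ge 1$ be integers, and let $\ell$ be the smallest positive integer such that $\ell \nmid n$. Then $s_{nt}'(\mathbb{Z}/n\mathbb{Z}) = (t+1)n - \ell + 1$.
   Context: A sequence over an abelian group $G$ is a finite sequence of elements of $G$ (repetition allowed); a subsequence is obtained by selecting some of its terms (not necessarily consecutive), and its length is the number of terms selected. A sequence is zero-sum if the sum of its terms is $0$. For a positive integer $k$, the modified Erdős–Ginzburg–Ziv constant $s_k'(G)$ is the smallest integer $L$ such that every zero-sum sequence over $G$ of length at least $L$ contains a zero-sum subsequence of length $k$. *)

theory Defs
  imports
    "HOL-Algebra.Elementary_Groups"
    "HOL-Library.Sublist"
    "HOL-Library.Extended_Nat"
begin

text \<open>Abelian groups are the (multiplicatively written) groups of HOL-Algebra, so the sum of a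
  sequence is its product in \<open>G\<close> and zero is \<open>\<one>\<close>. Sequences are lists, and \<open>subseq ys xs\<close>
  says that \<open>ys\<close> arises from \<open>xs\<close> by selecting some, not necessarily consecutive, terms.\<close>

definition zero_sum :: "('a, 'b) monoid_scheme \<Rightarrow> 'a list \<Rightarrow> bool" where
  "zero_sum G xs \<longleftrightarrow> set xs \<subseteq> carrier G \<and> foldr (\<otimes>\<^bsub>G\<^esub>) xs \<one>\<^bsub>G\<^esub> = \<one>\<^bsub>G\<^esub>"

definition has_zero_sum_subseq :: "('a, 'b) monoid_scheme \<Rightarrow> nat \<Rightarrow> 'a list \<Rightarrow> bool" where
  "has_zero_sum_subseq G k xs \<longleftrightarrow> (\<exists>ys. subseq ys xs \<and> length ys = k \<and> zero_sum G ys)"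

text \<open>The modified Erdos-Ginzburg-Ziv constant. The infimum of a nonempty set of extended naturals
  is its least element; the value is \<open>\<infinity>\<close> exactly if no \<open>L\<close> is suitable. An equation with a finite
  value therefore includes the existence of the smallest \<open>L\<close>.\<close>

definition modified_EGZ :: "('a, 'b) monoid_scheme \<Rightarrow> nat \<Rightarrow> enat" where
  "modified_EGZ G k =
     Inf {enat L | L. \<forall>xs. zero_sum G xs \<and> L \<le> length xs \<longrightarrow> has_zero_sum_subseq G k xs}"

end

theory Submission
  imports Defs "HOL-Number_Theory.Cong" "HOL-Library.Disjoint_Sets"
begin

text \<open>For \<open>j dvd n\<close>, a zero-sum sequence of length \<open>(t + 1) * n - j\<close> splits into
  \<open>(t + 1) * (n div j) - 1\<close> blocks of length \<open>j\<close> whose sums are divisible by \<open>j\<close>: the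
  Erdos-Ginzburg-Ziv theorem modulo \<open>j\<close> yields all blocks but the last, and the last one is forced by
  the total sum. Erdos-Ginzburg-Ziv modulo \<open>n div j\<close> then selects \<open>t * (n div j)\<close> blocks whose sums
  add up to a multiple of \<open>n\<close>. Every \<open>j < l\<close> divides \<open>n\<close>, and lengths from \<open>(t + 1) * n - 1\<close> on are
  covered by Erdos-Ginzburg-Ziv itself.

  If \<open>l < n\<close> and \<open>g = gcd l n\<close>, an extremal sequence consists of \<open>n - l + g\<close> zeros and \<open>n * t - g\<close>
  ones, shifted by a constant that makes the total sum zero; such a constant exists because \<open>g\<close> is
  a multiple of \<open>l\<close> modulo \<open>n\<close>. The shift does not change the sums of subsequences of length \<open>n * t\<close>.
  Otherwise the extremal sequence is too short to have a subsequence of length \<open>n * t\<close> at all.\<close>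

section \<open>The Erdos-Ginzburg-Ziv theorem for a prime modulus\<close>

text \<open>Since \<open>d\<close> is invertible modulo \<open>p\<close>, repeated shifts by
  \<open>d\<close> lead from any one residue to every other.\<close>

lemma residues_shift_closed_eq:
  fixes p :: nat and d :: int
  assumes "prime p" "\<not> int p dvd d" "S \<subseteq> {0..<int p}" "S \<noteq> {}"
    and closed: "\<And>s. s \<in> S \<Longrightarrow> (s + d) mod int p \<in> S"
  shows "S = {0..<int p}"
proof
  show "S \<subseteq> {0..<int p}" by fact
  show "{0..<int p} \<subseteq> S"
  proof
    fix r :: int assume r: "r \<in> {0..<int p}"
    from assms(4) obtain s where s: "s \<in> S" by auto
    have mult: "(s + int k * d) mod int p \<in> S" for k
    proof (induction k)
      case 0
      then show ?case using s assms(3) by (metis add.right_neutral atLeastLessThan_iff mod_pos_pos_trivial mult_zero_left of_nat_0 subsetD)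
    next
      case (Suc k)
      have "((s + int k * d) mod int p + d) mod int p \<in> S" using closed[OF Suc] .
      then show ?case by (simp add: mod_simps algebra_simps)
    qed
    have "coprime d (int p)"
      using assms(1,2) by (metis coprime_commute prime_imp_coprime prime_nat_int_transfer)
    then obtain e where e: "[d * e = 1] (mod int p)"
      using cong_solve_coprime_int by blast
    \<comment> \<open>With \<open>e\<close> inverse to \<open>d\<close>, this \<open>k\<close>
      solves \<open>s + k * d = r\<close> modulo \<open>p\<close>.\<close>
    define k where "k = nat (((r - s) * e) mod int p)"
    have "p > 0" using assms(1) by (simp add: prime_gt_0_nat)
    then have "int k = ((r - s) * e) mod int p" by (simp add: k_def)
    then have "[int k = (r - s) * e] (mod int p)" by (simp add: cong_def)
    then have "[int k * d = (r - s) * e * d] (mod int p)" by (rule cong_scalar_right)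
    also have "(r - s) * e * d = (r - s) * (d * e)" by (simp add: ac_simps)
    also have "[(r - s) * (d * e) = (r - s) * 1] (mod int p)" using e by (rule cong_scalar_left)
    finally have "[s + int k * d = s + (r - s)] (mod int p)" by (intro cong_add) auto
    then have "(s + int k * d) mod int p = r" using r by (simp add: cong_def)
    then show "r \<in> S" using mult[of k] by simp
  qed
qed

text \<open>This is Cauchy-Davenport for the two-element sets \<open>{0, d i}\<close>. A set of sums
  that is not yet everything is not closed under the shift by \<open>d k\<close>, so each new
  summand contributes at least one new residue.\<close>

lemma card_subset_sums_mod_prime:
  fixes p :: nat and d :: "nat \<Rightarrow> int"
  assumes "prime p" "k < p" "\<And>i. i < k \<Longrightarrow> \<not> int p dvd d i"
  shows "card ((\<lambda>I. sum d I mod int p) ` Pow {..<k}) \<ge> k + 1"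
  using assms(2,3)
proof (induction k)
  case 0
  then show ?case by simp
next
  case (Suc k)
  let ?S = "\<lambda>k. (\<lambda>I. sum d I mod int p) ` Pow {..<k}"
  have IH: "card (?S k) \<ge> k + 1" using Suc by auto
  have p0: "p > 0" using Suc by simp
  have sub: "?S j \<subseteq> {0..<int p}" for j using p0 by auto
  have fin: "finite (?S j)" for j by simp
  have mono: "?S k \<subseteq> ?S (Suc k)" by (intro image_mono) auto
  show ?case
  proof (cases "?S k = {0..<int p}")
    case True
    then have "card {0..<int p} \<le> card (?S (Suc k))" using mono fin by (metis card_mono)
    then show ?thesis using Suc.prems(1) by simp
  next
    case False
    then obtain s where s: "s \<in> ?S k" "(s + d k) mod int p \<notin> ?S k"
      using residues_shift_closed_eq[OF assms(1) Suc.prems(2)[of k] sub[of k]] by blast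
    from s(1) obtain I where I: "I \<subseteq> {..<k}" "s = sum d I mod int p" by auto
    have "k \<notin> I" "finite I" using I(1) finite_subset by auto
    then have "(s + d k) mod int p = sum d (insert k I) mod int p"
      by (simp add: I(2) mod_simps add.commute)
    moreover have "insert k I \<in> Pow {..<Suc k}" using I(1) by auto
    ultimately have "(s + d k) mod int p \<in> ?S (Suc k)" by blast
    then have "insert ((s + d k) mod int p) (?S k) \<subseteq> ?S (Suc k)" using mono by blast
    then have "card (insert ((s + d k) mod int p) (?S k)) \<le> card (?S (Suc k))"
      using fin card_mono by blast
    then show ?thesis using IH s(2) fin by simp
  qed
qed

lemma EGZ_prime_sorted:
  fixes p :: nat and g :: "nat \<Rightarrow> int"
  assumes "prime p" and sorted: "\<And>i j. i \<le> j \<Longrightarrow> j < 2 * p - 1 \<Longrightarrow> g i mod int p \<le> g j mod int p"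
  shows "\<exists>B \<subseteq> {..<2 * p - 1}. card B = p \<and> int p dvd sum g B"
proof -
  have p2: "p \<ge> 2" using assms(1) by (simp add: prime_ge_2_nat)
  \<comment> \<open>If no \<open>d i\<close> vanishes modulo \<open>p\<close>, choosing one element from each of the \<open>p - 1\<close> pairs
      \<open>{i, i + (p - 1)}\<close> produces sums in every residue class.\<close>
  define d where "d i = g (i + (p - 1)) - g i" for i
  show ?thesis
  proof (cases "\<exists>i < p. int p dvd d i")
    case True
    then obtain i where i: "i < p" "int p dvd d i" by auto
    then have eq: "g (i + (p - 1)) mod int p = g i mod int p"
      by (simp add: d_def mod_eq_dvd_iff)
    \<comment> \<open>Sortedness squeezes the residues between two equal ones, so \<open>p\<close>
      consecutive terms agree and their sum vanishes modulo \<open>p\<close>.\<close>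
    have all: "[g j = g i] (mod int p)" if "j \<in> {i..<i+p}" for j
    proof -
      have "g i mod int p \<le> g j mod int p" using that i p2 by (intro sorted) auto
      moreover have "g j mod int p \<le> g (i + (p - 1)) mod int p" using that i p2 by (intro sorted) auto
      ultimately show ?thesis using eq by (simp add: cong_def)
    qed
    have "[sum g {i..<i+p} = sum (\<lambda>_. g i) {i..<i+p}] (mod int p)"
      by (intro cong_sum all)
    then have "int p dvd sum g {i..<i+p}" by (simp add: cong_dvd_iff)
    then show ?thesis using i by (intro exI[of _ "{i..<i+p}"]) auto
  next
    case False
    let ?S = "(\<lambda>I. sum d I mod int p) ` Pow {..<p - 1}"
    have "card ?S \<ge> p - 1 + 1"
      using False p2 by (intro card_subset_sums_mod_prime assms(1)) auto
    moreover have "?S \<subseteq> {0..<int p}" using p2 by auto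
    ultimately have S: "?S = {0..<int p}" using p2 by (intro card_seteq) auto
    \<comment> \<open>\<open>c\<close> is the sum for the default choice: the lower index of every
      pair, plus the unpaired index \<open>2 * p - 2\<close>. Switching the pairs in
      \<open>I\<close> to their upper index adds \<open>sum d I\<close>, which has to cancel
      \<open>c\<close>.\<close>
    define c where "c = sum g {..<p - 1} + g (2 * p - 2)"
    have "(- c) mod int p \<in> ?S" unfolding S using p2 by simp
    then obtain I where I: "I \<subseteq> {..<p - 1}" "(- c) mod int p = sum d I mod int p" by auto
    have finI: "finite I" using I(1) finite_subset by blast
    define h where "h i = i + (p - 1)" for i
    have injh: "inj_on h I" by (auto simp: h_def inj_on_def)
    let ?B = "insert (2 * p - 2) (({..<p - 1} - I) \<union> h ` I)"
    have disj: "({..<p - 1} - I) \<inter> h ` I = {}" by (auto simp: h_def)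
    have notin: "2 * p - 2 \<notin> ({..<p - 1} - I) \<union> h ` I" using I(1) p2 by (auto simp: h_def)
    have cI: "card I \<le> p - 1" using I(1) by (metis card_lessThan card_mono finite_lessThan)
    have "card (({..<p - 1} - I) \<union> h ` I) = p - 1"
      using disj finI I(1) cI by (simp add: card_Un_disjoint card_Diff_subset card_image[OF injh])
    then have card: "card ?B = p" using notin finI p2 by simp
    have "sum g (({..<p - 1} - I) \<union> h ` I) = sum g ({..<p - 1} - I) + sum (g \<circ> h) I"
      using disj finI by (simp add: sum.union_disjoint sum.reindex[OF injh])
    also have "\<dots> = sum g {..<p - 1} + sum d I"
      using I(1) by (simp add: sum_diff finI d_def h_def sum_subtractf comp_def)
    finally have "sum g ?B = c + sum d I" using notin finI by (simp add: c_def)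
    moreover have "int p dvd c + sum d I"
      using I(2) by (metis add.inverse_inverse diff_minus_eq_add mod_eq_dvd_iff add.commute)
    ultimately have "int p dvd sum g ?B" by simp
    moreover have "?B \<subseteq> {..<2 * p - 1}" using I(1) p2 by (auto simp: h_def)
    ultimately show ?thesis using card by blast
  qed
qed

lemma EGZ_prime:
  fixes f :: "nat \<Rightarrow> int"
  assumes "prime p" "finite A" "card A \<ge> 2 * p - 1"
  shows "\<exists>B \<subseteq> A. card B = p \<and> int p dvd sum f B"
proof -
  \<comment> \<open>Sorting indices instead of values keeps the list distinct, so
    \<open>nth xs\<close> carries sets of positions injectively back to subsets of
    \<open>A\<close>.\<close>
  define xs where "xs = sort_key (\<lambda>i. f i mod int p) (sorted_list_of_set A)"
  have xs: "distinct xs" "set xs = A" "length xs = card A"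
    using assms(2) by (simp_all add: xs_def)
  have srt: "sorted (map (\<lambda>i. f i mod int p) xs)" by (simp add: xs_def)
  have "\<exists>B \<subseteq> {..<2 * p - 1}. card B = p \<and> int p dvd sum (\<lambda>i. f (xs ! i)) B"
  proof (intro EGZ_prime_sorted assms(1))
    fix i j :: nat assume "i \<le> j" "j < 2 * p - 1"
    then show "f (xs ! i) mod int p \<le> f (xs ! j) mod int p"
      using sorted_nth_mono[OF srt, of i j] xs(3) assms(3) by simp
  qed
  then obtain B where B: "B \<subseteq> {..<2 * p - 1}" "card B = p" "int p dvd sum (\<lambda>i. f (xs ! i)) B" by blast
  have "B \<subseteq> {..<length xs}" using B(1) xs(3) assms(3) by auto
  moreover from this have "inj_on (nth xs) B" using xs(1) by (auto intro!: inj_on_nth)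
  ultimately show ?thesis using B xs(2)
    by (intro exI[of _ "nth xs ` B"]) (auto simp: card_image sum.reindex)
qed

section \<open>Blocks, composite moduli and zero-sum sequences\<close>

text \<open>Blocks are removed greedily; even before the last removal \<open>2 * d - 1\<close>
  elements remain. Erdos-Ginzburg-Ziv is a hypothesis so that the lemma serves prime moduli first
  and arbitrary ones later.\<close>

lemma disjoint_blocks:
  fixes f :: "nat \<Rightarrow> int" and d :: nat
  assumes EGZ: "\<And>A. finite A \<Longrightarrow> card A \<ge> 2 * d - 1 \<Longrightarrow> \<exists>B \<subseteq> A. card B = d \<and> int d dvd sum f B"
    and "finite A" "card A \<ge> (k + 1) * d - 1"
  shows "\<exists>C. disjoint_family_on C {..<k} \<and> (\<forall>i<k. C i \<subseteq> A \<and> card (C i) = d \<and> int d dvd sum f (C i))"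
  using assms(2,3)
proof (induction k arbitrary: A)
  case 0
  then show ?case by (auto simp: disjoint_family_on_def)
next
  case (Suc k)
  have "card A \<ge> 2 * d - 1" using Suc.prems(2) by (simp add: algebra_simps)
  then obtain B where B: "B \<subseteq> A" "card B = d" "int d dvd sum f B" using EGZ Suc.prems by blast
  have "card (A - B) = card A - d" using B Suc.prems by (metis card_Diff_subset finite_subset)
  then have "card (A - B) \<ge> (k + 1) * d - 1" using Suc.prems(2) by simp
  then obtain C where C: "disjoint_family_on C {..<k}"
     "\<And>i. i < k \<Longrightarrow> C i \<subseteq> A - B \<and> card (C i) = d \<and> int d dvd sum f (C i)"
    using Suc.IH[of "A - B"] Suc.prems by auto
  have "disjoint_family_on (C(k := B)) (insert k {..<k})"
  proof -
    have "disjoint_family_on (C(k := B)) {..<k}"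
      using C(1) by (simp add: disjoint_family_on_def)
    moreover have "(C(k := B)) k \<inter> (\<Union>i\<in>{..<k}. (C(k := B)) i) = {}" using C(2) by fastforce
    ultimately show ?thesis by (subst disjoint_family_on_insert) auto
  qed
  then have "disjoint_family_on (C(k := B)) {..<Suc k}" by (simp add: lessThan_Suc)
  moreover have "\<forall>i<Suc k. (C(k := B)) i \<subseteq> A \<and> card ((C(k := B)) i) = d \<and> int d dvd sum f ((C(k := B)) i)"
    using C(2) B by (auto simp: less_Suc_eq)
  ultimately show ?case by blast
qed

text \<open>Each block acts as a single term of value \<open>sum f (C i) div int d\<close>, and a
  choice of blocks that is good modulo \<open>m\<close> becomes one modulo \<open>d * m\<close>.
  With \<open>m = 1\<close> this merely glues blocks together.\<close>

lemma UN_blocks: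
  fixes f :: "nat \<Rightarrow> int" and d m k :: nat
  assumes "disjoint_family_on C {..<k}" 
    and C: "\<And>i. i < k \<Longrightarrow> C i \<subseteq> A \<and> card (C i) = d \<and> int d dvd sum f (C i)"
    and "finite A" "K \<subseteq> {..<k}" "int m dvd (\<Sum>i\<in>K. sum f (C i) div int d)"
  shows "(\<Union>i\<in>K. C i) \<subseteq> A" "card (\<Union>i\<in>K. C i) = card K * d" "int (d * m) dvd sum f (\<Union>i\<in>K. C i)"
proof -
  have K: "finite K" using assms(4) by (rule finite_subset) simp
  have CK: "C i \<subseteq> A" "card (C i) = d" "int d dvd sum f (C i)" if "i \<in> K" for i
    using C[of i] that assms(4) by auto
  have fin: "finite (C i)" if "i \<in> K" for i using CK(1)[OF that] assms(3) by (rule finite_subset)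
  have disj: "\<forall>i\<in>K. \<forall>j\<in>K. i \<noteq> j \<longrightarrow> C i \<inter> C j = {}"
    using assms(1,4) unfolding disjoint_family_on_def by blast
  show "(\<Union>i\<in>K. C i) \<subseteq> A" using CK(1) by blast
  have "card (\<Union>i\<in>K. C i) = (\<Sum>i\<in>K. card (C i))" using K fin disj by (intro card_UN_disjoint) auto
  also have "\<dots> = (\<Sum>i\<in>K. d)" using CK(2) by simp
  finally show "card (\<Union>i\<in>K. C i) = card K * d" by simp
  have "sum f (\<Union>i\<in>K. C i) = (\<Sum>i\<in>K. sum f (C i))" using K fin disj by (intro sum.UNION_disjoint) auto
  also have "\<dots> = (\<Sum>i\<in>K. int d * (sum f (C i) div int d))"
    using CK(3) by simp
  also have "\<dots> = int d * (\<Sum>i\<in>K. sum f (C i) div int d)" by (simp add: sum_distrib_left)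
  finally show "int (d * m) dvd sum f (\<Union>i\<in>K. C i)" using assms(5) by (simp add: mult_dvd_mono)
qed

text \<open>The property is multiplicative: for \<open>n = p * m\<close> the prime case gives
  \<open>2 * m - 1\<close> blocks of size \<open>p\<close>, and the induction hypothesis for
  \<open>m\<close> selects \<open>m\<close> of them.\<close>

theorem Erdos_Ginzburg_Ziv:
  fixes f :: "nat \<Rightarrow> int"
  assumes "n > 0" "finite A" "card A \<ge> 2 * n - 1"
  shows "\<exists>B \<subseteq> A. card B = n \<and> int n dvd sum f B"
  using assms
proof (induction n arbitrary: A f rule: less_induct)
  case (less n)
  show ?case
  proof (cases "n = 1")
    case True
    then show ?thesis using less.prems obtain_subset_with_card_n[of 1 A] by auto
  next
    case False
    then obtain p where p: "prime p" "p dvd n" using prime_factor_nat by blast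
    then obtain m where m: "n = p * m" by auto
    then have m0: "m > 0" "m < n" using less.prems p prime_gt_1_nat[of p] by auto
    have "(2 * m - 1 + 1) * p - 1 = 2 * n - 1" using m m0 by (simp add: mult.commute mult.left_commute)
    then obtain C where C: "disjoint_family_on C {..<2*m-1}"
       "\<And>i. i < 2*m-1 \<Longrightarrow> C i \<subseteq> A \<and> card (C i) = p \<and> int p dvd sum f (C i)"
      using disjoint_blocks[of p f A "2 * m - 1"] EGZ_prime[OF p(1), of _ f] less.prems by auto
    obtain K where K: "K \<subseteq> {..<2*m-1}" "card K = m" "int m dvd (\<Sum>i\<in>K. sum f (C i) div int p)"
      using less.IH[OF m0(2,1), of "{..<2*m-1}" "\<lambda>i. sum f (C i) div int p"] by auto
    show ?thesis using UN_blocks[OF C less.prems(2) K(1,3)] K(2) m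
      by (intro exI[of _ "\<Union>i\<in>K. C i"]) (auto simp: mult.commute)
  qed
qed

text \<open>The union of \<open>t\<close> disjoint blocks of size \<open>n\<close> does it.\<close>

lemma EGZ_multiple:
  fixes f :: "nat \<Rightarrow> int"
  assumes "n > 0" "finite A" "card A \<ge> (t + 1) * n - 1"
  shows "\<exists>B \<subseteq> A. card B = n * t \<and> int n dvd sum f B"
proof -
  obtain C where C: "disjoint_family_on C {..<t}"
       "\<And>i. i < t \<Longrightarrow> C i \<subseteq> A \<and> card (C i) = n \<and> int n dvd sum f (C i)"
    using disjoint_blocks[of n f A t] Erdos_Ginzburg_Ziv[OF assms(1), of _ f] assms by auto
  show ?thesis using UN_blocks[OF C assms(2), of "{..<t}" 1]
    by (intro exI[of _ "\<Union>i\<in>{..<t}. C i"]) (auto simp: mult.commute)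
qed

lemma EGZ_zero_sum_divisor:
  fixes f :: "nat \<Rightarrow> int"
  assumes "n > 0" "t > 0" "finite A" "card A = (t + 1) * n - j" "j dvd n" "int n dvd sum f A"
  shows "\<exists>B \<subseteq> A. card B = n * t \<and> int n dvd sum f B"
proof -
  obtain m where m: "n = j * m" using assms(5) by auto
  have pos: "j > 0" "m > 0" using m assms(1) by auto
  \<comment> \<open>\<open>k\<close> is the number of blocks supplied by Erdos-Ginzburg-Ziv; the
    forced one makes \<open>k + 1\<close>. Nothing is truncated, as \<open>(t + 1) * m\<close> is at
    least 2.\<close>
  define k where "k = (t + 1) * m - 2"
  have k: "(t + 1) * m = k + 2" using pos assms(2) 
    by (cases t; cases m) (auto simp: k_def)
  have "(t + 1) * n = j * ((t + 1) * m)" using m by (simp only: ac_simps)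
  then have cA: "card A = (k + 1) * j" unfolding k assms(4) by (simp add: algebra_simps)
  obtain C where C: "disjoint_family_on C {..<k}"
       "\<And>i. i < k \<Longrightarrow> C i \<subseteq> A \<and> card (C i) = j \<and> int j dvd sum f (C i)"
    using disjoint_blocks[of j f A k] Erdos_Ginzburg_Ziv[OF pos(1), of _ f] assms(3) cA by auto
  define U where "U = (\<Union>i\<in>{..<k}. C i)"
  have U: "U \<subseteq> A" "card U = k * j" "int j dvd sum f U"
    using UN_blocks[OF C assms(3), of "{..<k}" 1] by (auto simp: U_def)
  have finU: "finite U" using U assms(3) finite_subset by blast
  \<comment> \<open>The leftover \<open>A - U\<close> is the forced block: it has \<open>j\<close>
    elements, and \<open>j\<close> divides both the total sum and that of \<open>U\<close>.\<close>
  define D where "D = C(k := A - U)"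
  have "card (A - U) = j" using U finU cA by (simp add: card_Diff_subset)
  moreover have "int j dvd sum f (A - U)"
    using U assms(3,6) m by (metis dvd_diff dvd_mult_left of_nat_mult sum_diff)
  ultimately have D: "D i \<subseteq> A \<and> card (D i) = j \<and> int j dvd sum f (D i)" if "i < k + 1" for i
    using C(2) that by (auto simp: D_def less_Suc_eq)
  have disj: "disjoint_family_on D {..<k + 1}"
  proof -
    have "disjoint_family_on D {..<k}"
      using C(1) by (simp add: disjoint_family_on_def D_def)
    moreover have "D k \<inter> (\<Union>i\<in>{..<k}. D i) = {}" by (auto simp: D_def U_def)
    ultimately have "disjoint_family_on D (insert k {..<k})" by (subst disjoint_family_on_insert) auto
    then show ?thesis by (simp add: lessThan_Suc)
  qed
  \<comment> \<open>\<open>k + 1 = (t + 1) * m - 1\<close> is just enough blocks for modulus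
    \<open>m\<close>.\<close>
  obtain K where K: "K \<subseteq> {..<k + 1}" "card K = m * t" "int m dvd (\<Sum>i\<in>K. sum f (D i) div int j)"
    using EGZ_multiple[OF pos(2), of "{..<k + 1}" t "\<lambda>i. sum f (D i) div int j"] k by auto
  show ?thesis using UN_blocks[OF disj D assms(3) K(1,3)] K(2) m
    by (intro exI[of _ "\<Union>i\<in>K. D i"]) (auto simp: ac_simps)
qed

section \<open>From index sets to subsequences\<close>

lemma zero_sum_integer_mod_group:
  assumes "n > 0"
  shows "zero_sum (integer_mod_group n) xs \<longleftrightarrow> set xs \<subseteq> {0..<int n} \<and> int n dvd sum_list xs"
proof -
  have "foldr (\<otimes>\<^bsub>integer_mod_group n\<^esub>) xs \<one>\<^bsub>integer_mod_group n\<^esub> = sum_list xs mod int n"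
    by (induction xs) (simp_all add: mult_integer_mod_group mod_simps)
  then show ?thesis using assms by (auto simp: zero_sum_def carrier_integer_mod_group dvd_eq_mod_eq_0)
qed

text \<open>Induction from the right: an appended term only concerns the index
  \<open>length xs\<close>, whereas a prepended one would shift all of \<open>B\<close>.\<close>

lemma sum_list_nths:
  fixes xs :: "'a::comm_monoid_add list"
  assumes "B \<subseteq> {..<length xs}"
  shows "sum_list (nths xs B) = (\<Sum>i\<in>B. xs ! i)"
  using assms
proof (induction xs arbitrary: B rule: rev_induct)
  case Nil
  then show ?case by simp
next
  case (snoc x xs)
  have fin: "finite B" using snoc.prems finite_subset by blast
  have "nths xs B = nths xs (B - {length xs})"
    by (simp add: nths_def) (rule arg_cong[of _ _ "map fst"], rule filter_cong, auto dest: set_zip_rightD)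
  moreover have "sum_list (nths xs (B - {length xs})) = (\<Sum>i\<in>B - {length xs}. xs ! i)"
    using snoc.prems by (intro snoc.IH) auto
  moreover have "\<dots> = (\<Sum>i\<in>B - {length xs}. (xs @ [x]) ! i)"
    using snoc.prems by (intro sum.cong) (auto simp: nth_append)
  ultimately show ?case using fin
    by (auto simp: nths_append sum.remove[of B "length xs"] add.commute)
qed

lemma has_zero_sum_subseqI:
  assumes "n > 0" "zero_sum (integer_mod_group n) xs"
    and "B \<subseteq> {..<length xs}" "int n dvd (\<Sum>i\<in>B. xs ! i)"
  shows "has_zero_sum_subseq (integer_mod_group n) (card B) xs"
proof -
  have "length (nths xs B) = card B"
    using assms(3) by (simp add: length_nths) (metis (no_types, lifting) Collect_cong Collect_mem_eq lessThan_iff subsetD)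
  moreover have "zero_sum (integer_mod_group n) (nths xs B)"
    using assms sum_list_nths[OF assms(3)] set_nths_subset[of xs B]
    by (auto simp: zero_sum_integer_mod_group)
  ultimately show ?thesis unfolding has_zero_sum_subseq_def
    by (metis subseq_conv_nths)
qed

section \<open>The lower bound\<close>

lemma extremal_sequence:
  fixes n t l :: nat
  assumes "t > 0" "l < n" "\<not> l dvd n" "l > 0"
  shows "\<exists>xs. zero_sum (integer_mod_group n) xs \<and> length xs = (t + 1) * n - l \<and>
    \<not> has_zero_sum_subseq (integer_mod_group n) (n * t) xs"
proof -
  define g where "g = gcd l n"
  have "g dvd l" "g dvd n" by (simp_all add: g_def)
  \<comment> \<open>\<open>g < l\<close> is where \<open>l\<close> not dividing \<open>n\<close>
    enters; it later gives \<open>a < n\<close>.\<close>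
  then have g: "g > 0" "g < l" using assms by (auto intro!: le_neq_implies_less dvd_imp_le intro: Nat.gr0I)
  have "l > 1" using assms(3,4) by (cases "l = 1") auto
  obtain c where c: "[int l * c = int g] (mod int n)"
    using cong_solve_int[of "int l" "int n"] by (auto simp: g_def)
  \<comment> \<open>\<open>x\<close> and \<open>y\<close> are zero and one shifted by
    \<open>- c\<close>, reduced to lie in the carrier.\<close>
  define x where "x = (- c) mod int n"
  define y where "y = (1 - c) mod int n"
  have xc: "[x = - c] (mod int n)" and yc: "[y = 1 - c] (mod int n)" by (simp_all add: x_def y_def)
  have "\<not> [x = y] (mod int n)"
  proof
    assume "[x = y] (mod int n)"
    then have "[- c = 1 - c] (mod int n)" using xc yc by (metis cong_sym cong_trans)
    then have "int n dvd 1" by (simp add: cong_iff_dvd_diff)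
    then show False using assms \<open>l > 1\<close> by simp
  qed
  then have xy: "x \<noteq> y" by auto
  have n0: "n > 0" using assms by simp
  have range: "x \<in> {0..<int n}" "y \<in> {0..<int n}" using n0 by (simp_all add: x_def y_def)
  have comb: "[int i * x + int j * y = int j - int (i + j) * c] (mod int n)" for i j
  proof -
    have "[int i * x + int j * y = int i * (- c) + int j * (1 - c)] (mod int n)"
      by (intro cong_add cong_mult xc yc cong_refl)
    then show ?thesis by (simp add: algebra_simps)
  qed
  define a where "a = n - l + g"
  define b where "b = n * t - g"
  have "n \<le> n * t" using assms by simp
  then have gnt: "g \<le> n * t" using g assms by linarith
  have len: "a + b = (t + 1) * n - l" using gnt g assms by (simp add: a_def b_def algebra_simps)
  define xs where "xs = replicate a x @ replicate b y"
  have "[sum_list xs = int b - int (a + b) * c] (mod int n)"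
    using comb[of a b] by (simp add: xs_def sum_list_replicate)
  \<comment> \<open>The length is \<open>- l\<close> modulo \<open>n\<close>, so the shift
    contributes \<open>l * c\<close>, which cancels the \<open>- g\<close> coming from
    \<open>b\<close>.\<close>
  also have "int b - int (a + b) * c = int n * (int t - (int t + 1) * c) + (int l * c - int g)"
    unfolding len using gnt \<open>n \<le> n * t\<close> assms by (simp add: b_def of_nat_diff algebra_simps)
  finally have "int n dvd sum_list xs \<longleftrightarrow> int n dvd int n * (int t - (int t + 1) * c) + (int l * c - int g)"
    by (rule cong_dvd_iff)
  moreover have "int n dvd int l * c - int g" using c by (simp add: cong_iff_dvd_diff)
  ultimately have "int n dvd sum_list xs" by simp
  then have "zero_sum (integer_mod_group n) xs"
    using n0 range by (auto simp: zero_sum_integer_mod_group xs_def)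
  moreover have "length xs = (t + 1) * n - l" using len by (simp add: xs_def)
  moreover have "\<not> has_zero_sum_subseq (integer_mod_group n) (n * t) xs"
  proof
    assume "has_zero_sum_subseq (integer_mod_group n) (n * t) xs"
    then obtain ys where ys: "subseq ys xs" "length ys = n * t" "int n dvd sum_list ys"
      using n0 by (auto simp: has_zero_sum_subseq_def zero_sum_integer_mod_group)
    have set: "set ys \<subseteq> {x, y}"
    proof -
      have "set ys \<subseteq> set xs" using ys(1) by (metis subseq_conv_nths set_nths_subset)
      then show ?thesis by (auto simp: xs_def)
    qed
    have cl: "count_list ys v \<le> count_list xs v" for v
      using list_emb_length[OF subseq_filter[OF ys(1), of "(=) v"]] by (simp add: count_list_eq_length_filter)
    define i where "i = count_list ys x"
    define j where "j = count_list ys y"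
    have ij: "length ys = i + j \<and> sum_list ys = int i * x + int j * y"
      using set unfolding i_def j_def using xy by (induction ys) (auto simp: algebra_simps)
    have "i \<le> a" "j \<le> b" using cl[of x] cl[of y] xy by (simp_all add: i_def j_def xs_def count_list_eq_length_filter)
    have "[sum_list ys = int j - int (n * t) * c] (mod int n)" using comb[of i j] ij ys(2) by simp
    then have "int n dvd int j - int (n * t) * c" using ys(3) cong_dvd_iff by blast
    \<comment> \<open>At length \<open>n * t\<close> the shift vanishes modulo \<open>n\<close>, so
      the number \<open>j\<close> of ones is a multiple of \<open>n\<close>. As
      \<open>j \<le> b < n * t\<close>, at least \<open>n\<close> terms must be zeros, but only
      \<open>a < n\<close> exist.\<close>
    then have "int n dvd int j" by (simp add: dvd_diff_left_iff mult.assoc)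
    then obtain q where q: "j = n * q" by auto
    have "b < n * t" using g gnt by (simp add: b_def)
    then have "n * q < n * t" using \<open>j \<le> b\<close> q by linarith
    then have "q + 1 \<le> t" by simp
    then have "n * (q + 1) \<le> n * t" by (rule mult_le_mono2)
    then have "i \<ge> n" using ij ys(2) q by simp
    then show False using \<open>i \<le> a\<close> g assms by (simp add: a_def)
  qed
  ultimately show ?thesis by blast
qed

section \<open>The value of the constant\<close>

theorem theorem1p3:
  fixes n t l :: nat
  assumes "n \<ge> 1"
    and "t \<ge> 1"
    and "l = (LEAST d. d > 0 \<and> \<not> d dvd n)"
  shows "modified_EGZ (integer_mod_group n) (n * t) = enat ((t + 1) * n - l + 1)"
proof -
  let ?G = "integer_mod_group n"
  let ?P = "\<lambda>L. \<forall>xs. zero_sum ?G xs \<and> L \<le> length xs \<longrightarrow> has_zero_sum_subseq ?G (n * t) xs"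
  \<comment> \<open>\<open>n + 1\<close> witnesses that the least non-divisor exists and bounds
    it.\<close>
  have ex: "n + 1 > 0 \<and> \<not> n + 1 dvd n" using assms(1) by (auto dest: dvd_imp_le)
  have l: "l > 0" "\<not> l dvd n" "l \<le> n + 1"
    using LeastI[of "\<lambda>d. d > 0 \<and> \<not> d dvd n", OF ex] Least_le[of "\<lambda>d. d > 0 \<and> \<not> d dvd n", OF ex] assms(3) by auto
  have dvd: "j dvd n" if "0 < j" "j < l" for j
    using not_less_Least that assms(3) by blast
  have "n * 1 \<le> n * t" using assms(2) by (intro mult_le_mono2)
  then have "(t + 1) * n \<ge> n + n" by simp
  then have big: "l \<le> (t + 1) * n" using l(3) assms(1) by linarith
  have upper: "?P ((t + 1) * n - l + 1)"
  proof (intro allI impI, elim conjE)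
    fix xs assume xs: "zero_sum ?G xs" "(t + 1) * n - l + 1 \<le> length xs"
    have "\<exists>B \<subseteq> {..<length xs}. card B = n * t \<and> int n dvd (\<Sum>i\<in>B. xs ! i)"
    proof (cases "length xs \<ge> (t + 1) * n - 1")
      case True
      then show ?thesis using EGZ_multiple[of n "{..<length xs}" t] assms(1) by auto
    next
      case False
      \<comment> \<open>The deficit \<open>j\<close> is less than \<open>l\<close>, hence divides
        \<open>n\<close> by minimality of \<open>l\<close>.\<close>
      define j where "j = (t + 1) * n - length xs"
      have "0 < j" "j < l" "length xs = (t + 1) * n - j" using False xs(2) big by (auto simp: j_def)
      moreover have "int n dvd (\<Sum>i<length xs. xs ! i)"
        using xs(1) assms(1) by (simp add: zero_sum_integer_mod_group sum_list_sum_nth atLeast0LessThan)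
      ultimately show ?thesis
        using EGZ_zero_sum_divisor[of n t "{..<length xs}" j] dvd assms by auto
    qed
    then obtain B where "B \<subseteq> {..<length xs}" "card B = n * t" "int n dvd (\<Sum>i\<in>B. xs ! i)" by blast
    then show "has_zero_sum_subseq ?G (n * t) xs"
      using has_zero_sum_subseqI[OF _ xs(1), of B] assms(1) by simp
  qed
  have "\<exists>xs. zero_sum ?G xs \<and> length xs = (t + 1) * n - l \<and> \<not> has_zero_sum_subseq ?G (n * t) xs"
  proof (cases "l < n")
    case True
    then show ?thesis using extremal_sequence l assms by simp
  next
    case False
    \<comment> \<open>Here \<open>l = n + 1\<close>, since \<open>l\<close> does not divide
      \<open>n\<close>; the zero sequence is then shorter than \<open>n * t\<close>.\<close>
    then have "l > n" using l by (cases "l = n") auto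
    moreover have "(t + 1) * n = n * t + n" by simp
    ultimately have "(t + 1) * n - l < n * t" using \<open>n * 1 \<le> n * t\<close> assms(1) by linarith
    then have "\<not> has_zero_sum_subseq ?G (n * t) (replicate ((t + 1) * n - l) 0)"
      by (auto simp: has_zero_sum_subseq_def dest: list_emb_length)
    moreover have "zero_sum ?G (replicate ((t + 1) * n - l) 0)"
      using assms(1) by (auto simp: zero_sum_integer_mod_group sum_list_replicate)
    ultimately show ?thesis by (metis length_replicate)
  qed
  \<comment> \<open>A counterexample of length exactly \<open>(t + 1) * n - l\<close> refutes every
    \<open>L\<close> up to that length.\<close>
  then have lower: "(t + 1) * n - l + 1 \<le> L" if "?P L" for L
    using that by (metis not_less_eq_eq Suc_eq_plus1)
  show ?thesis unfolding modified_EGZ_def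
  proof (intro antisym)
    show "Inf {enat L |L. ?P L} \<le> enat ((t + 1) * n - l + 1)" using upper by (intro Inf_lower) blast
    show "enat ((t + 1) * n - l + 1) \<le> Inf {enat L |L. ?P L}" 
      by (rule Inf_greatest) (use lower in auto)
  qed
qed

end
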